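(* Let $n\in\mathbb{N}$ and let $b,c\in\mathbb{R}$ with $b,c\notin\{0,-1,\dots,-n+1\}$. Then ${}_2F_1(-n,b;c;z)$ has all its zeros real and simple, and $(n-1)$ of them lie in (i) $(0,1)$ for $c>0$ and $c+n-2<b<c+n-1$; the remaining zero is in the interval $(1,\infty)$. (ii) $(1,\infty)$ for $b<1-n$ and $c+n-2<b<c+n-1$; the remaining zero lies in $(0,1)$. (iii) $(-\infty,0)$ for $c>0$ and $1-n<b<2-n$; the remaining zero lies in $(1,\infty)$.
   Context: For $n\in\mathbb{N}$ and real $b,c$ with $c\notin\{0,-1,\dots,-n+1\}$, the hypergeometric polynomial is ${}_2F_1(-n,b;c;z)=\sum_{k=0}^{n}\frac{(-n)_k(b)_k}{(c)_k}\frac{z^k}{k!}$, where $(\alpha)_0=1$ and $(\alpha)_k=\alpha(\alpha+1)\cdots(\alpha+k-1)$ for $k\ge1$. The condition $b\notin\{0,-1,\dots,-n+1\}$ ensures that it has degree exactly $n$. The assertion about reality and simplicity of the zeros is made for the parameter ranges listed in (i), (ii) and (iii).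
   Formalization: For n = 1 the location claims are asserted only if also b > 0 in (i), c < 0 in (ii), b < c in (iii); without this they fail, since the only zero is c/b (e.g. in (i), c = 1/2, b = -1/4 gives the zero -2). *)

theory Defs
  imports Complex_Main "HOL-Computational_Algebra.Polynomial"
begin

text \<open>The terminating hypergeometric series \<open>\<^sub>2F\<^sub>1(-n, b; c; z)\<close> as a polynomial in \<open>z\<close>.
  It is meaningful only for \<open>c \<notin> {0, -1, \<dots>, -n + 1}\<close>, since otherwise a denominator
  vanishes (and division by zero yields 0).\<close>

definition hypergeom_poly :: "nat \<Rightarrow> real \<Rightarrow> real \<Rightarrow> real poly" where
  "hypergeom_poly n b c =
     (\<Sum>k\<le>n. monom (pochhammer (- real n) k * pochhammer b k / pochhammer c k / fact k) k)"

text \<open>Zeros are taken in the complex plane, so that reality is a genuine assertion.\<close>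

definition all_zeros_real_simple :: "real poly \<Rightarrow> bool" where
  "all_zeros_real_simple p \<longleftrightarrow>
     (\<forall>z::complex. poly (map_poly complex_of_real p) z = 0 \<longrightarrow>
        z \<in> \<real> \<and> order z (map_poly complex_of_real p) = 1)"

end

theory Submission
  imports Defs "HOL-Analysis.Derivative"
begin

text \<open>With \<open>P\<^sub>k(b, c) = F(-k, b; c; \<cdot>)\<close>, the derivative of
  \<open>x\<^sup>c (1 - x)\<^bsup>b - c - k\<^esup> P\<^sub>k(b + 1, c + 1)\<close> is
  \<open>c x\<^bsup>c - 1\<^esup> (1 - x)\<^bsup>b - c - k - 1\<^esup> P\<^bsub>k + 1\<^esub>(b, c)\<close>. The weight vanishes at \<open>0\<close> if \<open>c > 0\<close> and at
  \<open>1\<close> if \<open>b > c + k\<close>, so by Rolle's theorem each step gains a zero in \<open>(0, 1)\<close>. In range (i) the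
  weight of the last step no longer vanishes at \<open>1\<close>: that step gains no zero, but it reverses the
  expected sign at \<open>1\<close>, which forces the remaining zero into \<open>(1, \<infinity>)\<close>. Ranges (ii) and (iii) reduce
  to (i) by the substitution \<open>z \<mapsto> 1/z\<close> and by Pfaff's transformation \<open>z \<mapsto> z/(z - 1)\<close>. In each case
  \<open>n\<close> distinct real zeros are exhibited for a polynomial of degree \<open>n\<close>, so all zeros are real and
  simple.\<close>

section \<open>Counting zeros\<close>

text \<open>Elements are added in increasing order: a witness between the old and the new maximum
  lies beyond all earlier witnesses, so it is new. The bounds by elements of \<open>S\<close> keep
  the zeros found by Rolle's theorem strictly inside the interval.\<close>

lemma finite_set_separated:
  fixes S :: "'a::linorder set"
  assumes "finite S"
    and "\<And>x y. x \<in> S \<Longrightarrow> y \<in> S \<Longrightarrow> x < y \<Longrightarrow> \<exists>z. x < z \<and> z < y \<and> P z"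
  shows "\<exists>T. finite T \<and> card T = card S - 1 \<and>
           (\<forall>z\<in>T. P z \<and> (\<exists>x\<in>S. x < z) \<and> (\<exists>y\<in>S. z < y))"
  using assms
proof (induction S rule: finite_linorder_max_induct)
  case empty
  show ?case by (intro exI[of _ "{}"]) simp
next
  case (insert m A)
  show ?case
  proof (cases "A = {}")
    case True
    then show ?thesis by (intro exI[of _ "{}"]) simp
  next
    case False
    obtain T where T: "finite T" "card T = card A - 1"
      "\<forall>z\<in>T. P z \<and> (\<exists>x\<in>A. x < z) \<and> (\<exists>y\<in>A. z < y)"
      using insert.IH insert.prems by (metis insertCI)
    have Max: "Max A \<in> A" "Max A < m"
      using False insert.hyps by auto
    obtain z where z: "Max A < z" "z < m" "P z"
      using insert.prems[of "Max A" m] Max by auto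
    have "z \<notin> T"
      using T(3) z(1) insert.hyps(1) by (meson Max_ge leD order.strict_trans2 order.strict_trans)
    moreover have "card A > 0" "m \<notin> A"
      using False insert.hyps by (auto simp: card_gt_0_iff)
    ultimately have "card (insert z T) = card (insert m A) - 1"
      using T insert.hyps by simp
    then show ?thesis
      using T z Max by (intro exI[of _ "insert z T"]) auto
  qed
qed

lemma all_zeros_real_simple_if_card:
  fixes p :: "real poly"
  assumes "degree p = n" and "p \<noteq> 0" and R: "finite R" "card R = n" "\<And>x. x \<in> R \<Longrightarrow> poly p x = 0"
  shows "all_zeros_real_simple p"
  unfolding all_zeros_real_simple_def
proof (intro allI impI)
  fix z :: complex
  define q where "q = map_poly complex_of_real p"
  assume "poly (map_poly complex_of_real p) z = 0"
  then have z: "poly q z = 0" by (simp add: q_def)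
  have q: "q \<noteq> 0" "degree q = n"
    using assms by (simp_all add: q_def map_poly_eq_0_iff degree_map_poly)
  have of_real: "poly q (complex_of_real x) = complex_of_real (poly p x)" for x
    unfolding q_def by (induction p) (auto simp: map_poly_pCons)
  define R' where "R' = complex_of_real ` R"
  have R': "finite R'" "card R' = n" "\<And>x. x \<in> R' \<Longrightarrow> poly q x = 0"
    using R by (auto simp: R'_def card_image inj_on_def of_real)
  have le: "card A \<le> degree s" if "s \<noteq> 0" "\<And>x. x \<in> A \<Longrightarrow> poly s x = 0" for A and s :: "complex poly"
  proof -
    have "card A \<le> card {x. poly s x = 0}"
      using that by (intro card_mono poly_roots_finite) auto
    then show ?thesis using card_poly_roots_bound[OF that(1)] by simp
  qed
  have "z \<in> R'"
  proof (rule ccontr)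
    assume "z \<notin> R'"
    then have "card (insert z R') = Suc n" using R' by simp
    moreover have "card (insert z R') \<le> n" using le[of q "insert z R'"] R' z q by auto
    ultimately show False by simp
  qed
  then have "z \<in> \<real>" by (auto simp: R'_def)
  obtain s where s: "q = [:-z, 1:] * s"
    using z by (metis poly_eq_0_iff_dvd dvdE)
  have "s \<noteq> 0" using q s by auto
  have "n = Suc (degree s)"
    using q s \<open>s \<noteq> 0\<close> by (simp add: degree_mult_eq del: mult_pCons_left)
  \<comment> \<open>If the cofactor \<open>s\<close> vanished at \<open>z\<close> too, it would
    vanish at all \<open>n\<close> points of \<open>R'\<close>, although its degree is
    \<open>n - 1\<close>.\<close>
  have "poly s z \<noteq> 0"
  proof
    assume "poly s z = 0"
    then have "card R' \<le> degree s"
      using R'(3) \<open>s \<noteq> 0\<close> by (intro le) (auto simp: s)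
    then show False using R' \<open>n = Suc (degree s)\<close> by simp
  qed
  have "order z q = order z [:-z, 1:] + order z s"
    using q s by (metis order_mult)
  also have "\<dots> = 1"
    using order_power_n_n[of z 1] order_0I[OF \<open>poly s z \<noteq> 0\<close>] by simp
  finally have "order z q = 1" .
  with \<open>z \<in> \<real>\<close> show "z \<in> \<real> \<and> order z (map_poly complex_of_real p) = 1"
    by (simp add: q_def)
qed

text \<open>The \<open>n - 1\<close> zeros in \<open>S\<close> and the zero \<open>y\<close> exhaust
  the degree, so lower bounds on the numbers of zeros become exact counts.\<close>

lemma zeros_split:
  fixes p :: "real poly"
  assumes "degree p = n" and "p \<noteq> 0" and "n \<ge> 1"
    and S: "finite S" "card S = n - 1" "\<And>x. x \<in> S \<Longrightarrow> P x \<and> poly p x = 0"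
    and y: "Q y" "poly p y = 0" and PQ: "\<And>x. P x \<Longrightarrow> \<not> Q x"
  shows "all_zeros_real_simple p \<and> card {x. P x \<and> poly p x = 0} = n - 1 \<and>
         (\<exists>!x. Q x \<and> poly p x = 0)"
proof -
  have "y \<notin> S" using S PQ y by blast
  then have card: "card (insert y S) = n" using S assms(3) by simp
  have "card {x. poly p x = 0} \<le> n" using card_poly_roots_bound[OF assms(2)] assms(1) by simp
  moreover have "finite {x. poly p x = 0}" using poly_roots_finite assms(2) by blast
  moreover have "insert y S \<subseteq> {x. poly p x = 0}" using S y by auto
  ultimately have eq: "insert y S = {x. poly p x = 0}"
    using card by (intro card_seteq) auto
  have "all_zeros_real_simple p"
    using all_zeros_real_simple_if_card[OF assms(1,2), of "insert y S"] S card y by auto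
  moreover have "{x. P x \<and> poly p x = 0} = S" using eq S(3) PQ[of y] y by (auto dest: equalityD2)
  moreover have "\<exists>!x. Q x \<and> poly p x = 0"
    using eq S PQ y by (intro ex1I[of _ y]) auto
  ultimately show ?thesis using S by simp
qed

section \<open>Coefficients and degree\<close>

lemma coeff_hypergeom_poly:
  "coeff (hypergeom_poly n b c) k =
     pochhammer (- real n) k * pochhammer b k / pochhammer c k / fact k"
proof (cases "k \<le> n")
  case True
  then show ?thesis by (simp add: hypergeom_poly_def coeff_sum coeff_monom if_distrib cong: if_cong)
next
  case False
  then have "pochhammer (- real n) k = 0" by (intro pochhammer_of_nat_eq_0_lemma) simp
  with False show ?thesis by (simp add: hypergeom_poly_def coeff_sum)
qed

lemma poly_hypergeom_poly_0 [simp]: "poly (hypergeom_poly n b c) 0 = 1"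
  by (simp add: poly_0_coeff_0 coeff_hypergeom_poly)

lemma degree_hypergeom_poly_le: "degree (hypergeom_poly n b c) \<le> n"
  by (intro degree_le allI impI)
     (simp add: coeff_hypergeom_poly pochhammer_of_nat_eq_0_lemma)

lemma hypergeom_poly_nonzero: "hypergeom_poly n b c \<noteq> 0"
  using poly_hypergeom_poly_0[of n b c] by force

lemma pochhammer_nonzero_iff_notin:
  fixes x :: real
  shows "pochhammer x n \<noteq> 0 \<longleftrightarrow> x \<notin> {- real j | j. j < n}"
  by (auto simp: pochhammer_eq_0_iff)

lemma lead_coeff_hypergeom_poly:
  "coeff (hypergeom_poly n b c) n = (- 1) ^ n * pochhammer b n / pochhammer c n"
  by (simp add: coeff_hypergeom_poly pochhammer_same field_simps)

lemma degree_hypergeom_poly: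
  assumes "pochhammer b n \<noteq> 0" and "pochhammer c n \<noteq> 0"
  shows "degree (hypergeom_poly n b c) = n"
  using assms
  by (intro antisym degree_hypergeom_poly_le le_degree) (simp add: lead_coeff_hypergeom_poly)


section \<open>Two differential recurrences\<close>

lemma coeff_weighted_deriv:
  fixes p :: "real poly"
  shows "coeff ([:c, d:] * p + [:0, 1, -1:] * pderiv p) 0 = c * coeff p 0"
    and "coeff ([:c, d:] * p + [:0, 1, -1:] * pderiv p) (Suc i) =
           (c + 1 + real i) * coeff p (Suc i) + (d - real i) * coeff p i"
  by (auto simp: coeff_pderiv coeff_pCons algebra_simps split: nat.split)

text \<open>The derivative formula for the weighted polynomial with the weight cancelled;
  \<open>[:0, 1, -1:]\<close> is x(1 - x).\<close>

lemma hypergeom_poly_rodrigues_step: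
  assumes "c > 0"
  shows "smult c (hypergeom_poly (Suc k) b c) =
    [:c, real k - b:] * hypergeom_poly k (b + 1) (c + 1)
    + [:0, 1, -1:] * pderiv (hypergeom_poly k (b + 1) (c + 1))" (is "?L = ?R")
proof (rule poly_eqI)
  fix j
  show "coeff ?L j = coeff ?R j"
  proof (cases j)
    case 0
    then show ?thesis by (simp only: coeff_weighted_deriv) (simp add: coeff_hypergeom_poly)
  next
    case (Suc i)
    have nz: "pochhammer (c + 1) i \<noteq> 0" "c + 1 + real i \<noteq> 0" "real i + 1 \<noteq> 0"
      using assms by (auto simp: pochhammer_eq_0_iff)
    \<comment> \<open>Common factor of the three coefficients; what remains is (i - k)(b + 1 + i) +
      (k - b - i)(i + 1) = -(k + 1)b.\<close>
    define D where "D = pochhammer (- real k) i * pochhammer (b + 1) i / pochhammer (c + 1) i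
      / ((real i + 1) * fact i)"
    have m: "- real (Suc k) + 1 = - real k" by simp
    have "c * coeff (hypergeom_poly (Suc k) b c) (Suc i) = - (real k + 1) * b * D"
      unfolding coeff_hypergeom_poly pochhammer_rec m D_def using assms nz
      by (simp add: divide_simps) (simp add: algebra_simps)
    moreover have "(c + 1 + real i) * coeff (hypergeom_poly k (b + 1) (c + 1)) (Suc i) =
        (real i - real k) * (b + 1 + real i) * D"
      unfolding coeff_hypergeom_poly D_def pochhammer_Suc using nz
      by (simp add: divide_simps)
    moreover have "coeff (hypergeom_poly k (b + 1) (c + 1)) i = (real i + 1) * D"
      unfolding coeff_hypergeom_poly D_def by simp
    ultimately show ?thesis
      unfolding Suc coeff_weighted_deriv coeff_smult by (simp add: algebra_simps)
  qed
qed

text \<open>Counterpart of the previous recurrence under Pfaff's transformation: shifting both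
  \<open>b\<close> and \<open>c\<close> by 1 leaves c - b fixed, so on the transformed side only the
  lower parameter moves.\<close>

lemma hypergeom_poly_contiguous_step:
  assumes "c > 0"
  shows "smult c (hypergeom_poly (Suc k) b c) =
    [:c, - b:] * hypergeom_poly k b (c + 1)
    + [:0, 1, -1:] * pderiv (hypergeom_poly k b (c + 1))" (is "?L = ?R")
proof (rule poly_eqI)
  fix j
  show "coeff ?L j = coeff ?R j"
  proof (cases j)
    case 0
    then show ?thesis by (simp only: coeff_weighted_deriv) (simp add: coeff_hypergeom_poly)
  next
    case (Suc i)
    have nz: "pochhammer (c + 1) i \<noteq> 0" "c + 1 + real i \<noteq> 0" "real i + 1 \<noteq> 0"
      using assms by (auto simp: pochhammer_eq_0_iff)
    define D where "D = pochhammer (- real k) i * pochhammer b i / pochhammer (c + 1) i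
      / ((real i + 1) * fact i)"
    have m: "- real (Suc k) + 1 = - real k" by simp
    have "c * coeff (hypergeom_poly (Suc k) b c) (Suc i) = - (real k + 1) * (b + real i) * D"
      unfolding coeff_hypergeom_poly D_def pochhammer_rec[of "- real (Suc k)"]
        pochhammer_rec[of c] pochhammer_Suc[of b] m using assms nz
      by (simp add: divide_simps) (simp add: algebra_simps)
    moreover have "(c + 1 + real i) * coeff (hypergeom_poly k b (c + 1)) (Suc i) =
        (real i - real k) * (b + real i) * D"
      unfolding coeff_hypergeom_poly D_def pochhammer_Suc using nz
      by (simp add: divide_simps)
    moreover have "coeff (hypergeom_poly k b (c + 1)) i = (real i + 1) * D"
      unfolding coeff_hypergeom_poly D_def by simp
    ultimately show ?thesis
      unfolding Suc coeff_weighted_deriv coeff_smult by (simp add: algebra_simps)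
  qed
qed

section \<open>Rolle's theorem with the weight\<close>

lemma has_derivative_jacobi_weight:
  fixes p :: "real poly"
  assumes "0 < x" "x < 1"
  shows "((\<lambda>x. x powr c * (1 - x) powr d * poly p x) has_real_derivative
    x powr (c - 1) * (1 - x) powr (d - 1) *
      poly ([:c, - c - d:] * p + [:0, 1, -1:] * pderiv p) x) (at x)"
proof -
  have "((\<lambda>x. (1 - x) powr d) has_real_derivative (d * (1 - x) powr (d - 1) * (- 1))) (at x)"
    using assms
    by (intro DERIV_chain'[where g = "\<lambda>y. y powr d"] has_real_derivative_powr)
       (auto intro!: derivative_eq_intros)
  moreover have "((\<lambda>x. x powr c) has_real_derivative (c * x powr (c - 1))) (at x)"
    using assms by (intro has_real_derivative_powr) auto
  moreover have "(poly p has_real_derivative poly (pderiv p) x) (at x)" by (rule poly_DERIV)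
  ultimately have "((\<lambda>x. x powr c * (1 - x) powr d * poly p x) has_real_derivative
      (c * x powr (c - 1) * (1 - x) powr d + d * (1 - x) powr (d - 1) * (- 1) * x powr c) * poly p x
      + poly (pderiv p) x * (x powr c * (1 - x) powr d)) (at x)"
    by (intro DERIV_mult)
  moreover have "x powr c = x * x powr (c - 1)" "(1 - x) powr d = (1 - x) * (1 - x) powr (d - 1)"
    using assms by (simp_all add: powr_mult_base)
  ultimately show ?thesis by (simp add: algebra_simps)
qed

text \<open>\<open>S\<close> may contain 0 and 1, where the weight supplies the zero instead of
  \<open>p\<close>. Inside (0, 1) the weight is positive, so zeros of the derivative are zeros of
  the polynomial factor.\<close>

lemma rolle_jacobi_weight:
  fixes p :: "real poly"
  assumes "c > 0" "finite S" "S \<subseteq> {0..1}" "1 \<in> S \<Longrightarrow> d > 0"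
    and "\<And>x. x \<in> S \<Longrightarrow> 0 < x \<Longrightarrow> x < 1 \<Longrightarrow> poly p x = 0"
  shows "\<exists>T. finite T \<and> card T = card S - 1 \<and> T \<subseteq> {0<..<1} \<and>
    (\<forall>z\<in>T. poly ([:c, - c - d:] * p + [:0, 1, -1:] * pderiv p) z = 0)"
proof -
  let ?q = "[:c, - c - d:] * p + [:0, 1, -1:] * pderiv p"
  define f where "f = (\<lambda>x. x powr c * (1 - x) powr d * poly p x)"
  have f0: "f x = 0" if "x \<in> S" for x
    using assms that by (cases "x = 0 \<or> x = 1") (force simp: f_def)+
  have "\<exists>z. x < z \<and> z < y \<and> poly ?q z = 0" if xy: "x \<in> S" "y \<in> S" "x < y" for x y
  proof -
    have bounds: "0 \<le> x" "y \<le> 1" using assms(3) xy by auto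
    \<comment> \<open>Needed for continuity: \<open>0 powr d\<close> is 0 by convention for every
      \<open>d\<close>, but the weight tends to 0 at 1 only if d > 0. For y < 1 the base 1 - z stays
      positive.\<close>
    have d: "z < 1 \<or> d > 0" if "z \<le> y" for z
      using assms(4) xy(2) bounds that by (cases "y = 1") auto
    have deriv: "(f has_real_derivative z powr (c - 1) * (1 - z) powr (d - 1) * poly ?q z) (at z)"
      if "x < z" "z < y" for z
      unfolding f_def using bounds that by (intro has_derivative_jacobi_weight) auto
    have "continuous_on {x..y} f"
      unfolding f_def using bounds \<open>c > 0\<close> d
      by (intro continuous_intros continuous_on_powr') force+
    then obtain z where z: "x < z" "z < y" "(f has_real_derivative 0) (at z)"
      using Rolle[of x y f] xy f0 deriv by (auto simp: real_differentiable_def)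
    have "z powr (c - 1) * (1 - z) powr (d - 1) * poly ?q z = 0"
      using DERIV_unique[OF deriv z(3)] z by simp
    then have "poly ?q z = 0" using z bounds by simp
    with z show ?thesis by blast
  qed
  then obtain T where T: "finite T" "card T = card S - 1"
    "\<forall>z\<in>T. poly ?q z = 0 \<and> (\<exists>x\<in>S. x < z) \<and> (\<exists>y\<in>S. z < y)"
    using finite_set_separated[OF assms(2), of "\<lambda>z. poly ?q z = 0"] by blast
  then have "T \<subseteq> {0<..<1}" using assms(3) by force
  with T show ?thesis by blast
qed

lemma hypergeom_poly_zeros_step:
  assumes "c > 0" "finite S" "S \<subseteq> {0..1}" "1 \<in> S \<Longrightarrow> b > c + real k"
    and "\<And>x. x \<in> S \<Longrightarrow> 0 < x \<Longrightarrow> x < 1 \<Longrightarrow> poly (hypergeom_poly k (b + 1) (c + 1)) x = 0"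
  shows "\<exists>T. finite T \<and> card T = card S - 1 \<and> T \<subseteq> {0<..<1} \<and>
    (\<forall>z\<in>T. poly (hypergeom_poly (Suc k) b c) z = 0)"
proof -
  have "- c - (b - c - real k) = real k - b" by simp
  then have "smult c (hypergeom_poly (Suc k) b c) =
    [:c, - c - (b - c - real k):] * hypergeom_poly k (b + 1) (c + 1)
    + [:0, 1, -1:] * pderiv (hypergeom_poly k (b + 1) (c + 1))"
    using hypergeom_poly_rodrigues_step[OF assms(1)] by simp
  moreover have "poly (hypergeom_poly (Suc k) b c) z = 0 \<longleftrightarrow> poly (smult c (hypergeom_poly (Suc k) b c)) z = 0" for z
    using assms(1) by simp
  moreover have "1 \<in> S \<Longrightarrow> b - c - real k > 0" using assms(4) by simp
  ultimately show ?thesis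
    using rolle_jacobi_weight[OF assms(1-3) _ assms(5), of "b - c - real k"] by presburger
qed

section \<open>Zeros in (0, 1) and the sign at 1\<close>

lemma hypergeom_poly_1_step:
  assumes "c > 0"
  shows "c * poly (hypergeom_poly (Suc k) b c) 1 =
    (c + real k - b) * poly (hypergeom_poly k (b + 1) (c + 1)) 1"
  using arg_cong[OF hypergeom_poly_rodrigues_step[OF assms, of k b], of "\<lambda>p. poly p 1"]
  by (simp add: algebra_simps)

text \<open>The sign at 1 is carried along because range (i) needs it: each step multiplies the
  value by (c + k - b)/c, which is negative here.\<close>

lemma hypergeom_poly_jacobi_range:
  assumes "c > 0" "b > c + real k - 1"
  shows "(\<exists>S. finite S \<and> card S = k \<and> S \<subseteq> {0<..<1} \<and>
      (\<forall>x\<in>S. poly (hypergeom_poly k b c) x = 0)) \<and>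
    (- 1) ^ k * poly (hypergeom_poly k b c) 1 > 0"
  using assms
proof (induction k arbitrary: b c)
  case 0
  then show ?case by (simp add: hypergeom_poly_def monom_0)
next
  case (Suc k)
  then have IH: "\<exists>S. finite S \<and> card S = k \<and> S \<subseteq> {0<..<1} \<and>
      (\<forall>x\<in>S. poly (hypergeom_poly k (b + 1) (c + 1)) x = 0)"
    "(- 1) ^ k * poly (hypergeom_poly k (b + 1) (c + 1)) 1 > 0"
    using Suc.IH[of "c + 1" "b + 1"] by simp_all
  then obtain S where S: "finite S" "card S = k" "S \<subseteq> {0<..<1}"
      "\<And>x. x \<in> S \<Longrightarrow> poly (hypergeom_poly k (b + 1) (c + 1)) x = 0"
    by blast
  \<comment> \<open>The \<open>k\<close> inner zeros and both endpoints are k + 2 points, hence k +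
    1 gaps.\<close>
  have "0 \<notin> insert 1 S" "1 \<notin> S" using S by auto
  then have "card (insert 0 (insert 1 S)) - 1 = Suc k" using S by simp
  moreover have "\<exists>T. finite T \<and> card T = card (insert 0 (insert 1 S)) - 1 \<and> T \<subseteq> {0<..<1} \<and>
    (\<forall>z\<in>T. poly (hypergeom_poly (Suc k) b c) z = 0)"
    using Suc.prems S by (intro hypergeom_poly_zeros_step) auto
  moreover have "(- 1) ^ Suc k * poly (hypergeom_poly (Suc k) b c) 1 > 0"
  proof -
    have "c * ((- 1) ^ Suc k * poly (hypergeom_poly (Suc k) b c) 1) =
      (- 1) ^ Suc k * (c * poly (hypergeom_poly (Suc k) b c) 1)" by simp
    also have "\<dots> = (b - c - real k) * ((- 1) ^ k * poly (hypergeom_poly k (b + 1) (c + 1)) 1)"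
      unfolding hypergeom_poly_1_step[OF Suc.prems(1)] by (simp add: algebra_simps)
    also have "\<dots> > 0" using Suc.prems by (intro mult_pos_pos[OF _ IH(2)]) simp
    finally show ?thesis using Suc.prems(1) zero_less_mult_pos by blast
  qed
  ultimately show ?case by simp
qed

lemma hypergeom_poly_zeros_quasi_jacobi:
  assumes "n \<ge> 1" "c > 0" "b > 0" "c + real n - 2 < b" "b < c + real n - 1"
  obtains S y where "finite S" "card S = n - 1" "S \<subseteq> {0<..<1}"
    "\<forall>x\<in>S. poly (hypergeom_poly n b c) x = 0"
    "y > 1" "poly (hypergeom_poly n b c) y = 0"
proof -
  obtain k where k: "n = Suc k" using assms(1) by (cases n) auto
  have "c + 1 > 0" "b + 1 > (c + 1) + real k - 1" using assms k by simp_all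
  from hypergeom_poly_jacobi_range[OF this]
  obtain S where S: "finite S" "card S = k" "S \<subseteq> {0<..<1}"
      "\<And>x. x \<in> S \<Longrightarrow> poly (hypergeom_poly k (b + 1) (c + 1)) x = 0"
    and at1: "(- 1) ^ k * poly (hypergeom_poly k (b + 1) (c + 1)) 1 > 0"
    by blast
  \<comment> \<open>Only the endpoint 0 is added: now b < c + k, so the weight exponent at 1 is
    negative. This leaves k = n - 1 gaps.\<close>
  have "\<exists>T. finite T \<and> card T = card (insert 0 S) - 1 \<and> T \<subseteq> {0<..<1} \<and>
    (\<forall>z\<in>T. poly (hypergeom_poly (Suc k) b c) z = 0)"
    using assms S by (intro hypergeom_poly_zeros_step) auto
  moreover have "card (insert 0 S) = Suc k" using S by (subst card_insert_disjoint) auto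
  ultimately obtain T where T: "finite T" "card T = n - 1" "T \<subseteq> {0<..<1}"
    "\<forall>x\<in>T. poly (hypergeom_poly n b c) x = 0"
    using k by auto
  \<comment> \<open>This sign makes the leading coefficient positive, as b and c are positive. At 1
    the last factor b - c - k is negative, so \<open>p\<close> changes sign beyond 1.\<close>
  define p where "p = smult ((- 1) ^ n) (hypergeom_poly n b c)"
  have pos: "pochhammer b n > 0" "pochhammer c n > 0" using assms by (auto intro: pochhammer_pos)
  have "lead_coeff p = pochhammer b n / pochhammer c n"
    using degree_hypergeom_poly[of b n c] pos
    by (simp add: p_def lead_coeff_hypergeom_poly)
  then have "lead_coeff p > 0" using pos by simp
  then obtain m where m: "\<And>x. x \<ge> m \<Longrightarrow> poly p x \<ge> lead_coeff p"
    using poly_pinfty_gt_lc by blast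
  then have "poly p (max m 2) > 0" using \<open>lead_coeff p > 0\<close> order_less_le_trans by (meson max.cobounded1)
  moreover have "poly p 1 < 0"
  proof -
    have "c * poly p 1 = (- 1) ^ n * (c * poly (hypergeom_poly n b c) 1)" by (simp add: p_def)
    also have "\<dots> = (b - c - real k) * ((- 1) ^ k * poly (hypergeom_poly k (b + 1) (c + 1)) 1)"
      unfolding k hypergeom_poly_1_step[OF assms(2)] by (simp add: algebra_simps)
    also have "\<dots> < 0" using at1 assms k by (intro mult_neg_pos) auto
    finally show ?thesis using assms(2) by (simp add: mult_less_0_iff)
  qed
  ultimately obtain y where "y > 1" "poly p y = 0"
    using poly_IVT_pos[of 1 "max m 2" p] by force
  then have "poly (hypergeom_poly n b c) y = 0" by (simp add: p_def)
  with T \<open>y > 1\<close> show thesis by (intro that)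
qed

section \<open>The substitutions z -> 1/z and z -> z/(z - 1)\<close>

text \<open>The last \<open>j\<close> factors of the product are read backwards, each with its sign
  changed.\<close>

lemma pochhammer_split_reflect:
  fixes x :: real
  assumes "j \<le> n"
  shows "pochhammer x n = pochhammer x (n - j) * ((- 1) ^ j * pochhammer (1 - x - real n) j)"
proof -
  have "pochhammer x n = pochhammer x (n - j) * pochhammer (x + real (n - j)) j"
    using pochhammer_product[of "n - j" n x] assms by simp
  moreover have "pochhammer (1 - x - real n) j = (- 1) ^ j * pochhammer (x + real (n - j)) j"
    using pochhammer_minus[of "x + real n - 1" j] assms by (simp add: algebra_simps of_nat_diff)
  ultimately show ?thesis by simp
qed

lemma poly_hypergeom_poly:
  "poly (hypergeom_poly n b c) x = (\<Sum>k\<le>n. coeff (hypergeom_poly n b c) k * x ^ k)"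
  unfolding coeff_hypergeom_poly by (simp add: hypergeom_poly_def poly_sum poly_monom)

lemma hypergeom_poly_reverse:
  assumes "pochhammer b n \<noteq> 0" "pochhammer c n \<noteq> 0" "x \<noteq> 0"
  shows "poly (hypergeom_poly n b c) x = (- 1) ^ n * pochhammer b n / pochhammer c n * x ^ n *
    poly (hypergeom_poly n (1 - c - real n) (1 - b - real n)) (1 / x)"
proof -
  define K where "K = (- 1) ^ n * pochhammer b n / pochhammer c n"
  have coeff: "coeff (hypergeom_poly n b c) (n - j) =
      K * coeff (hypergeom_poly n (1 - c - real n) (1 - b - real n)) j" if "j \<le> n" for j
  proof -
    note split = pochhammer_split_reflect[OF that]
    \<comment> \<open>For x = -n the reflected parameter 1 - x - n is 1, so the reflected symbol is
      a factorial.\<close>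
    have "pochhammer (- real n) (n - j) * fact j = (- 1) ^ n * (- 1) ^ j * fact n"
      using split[of "- real n"]
      by (cases "even j") (simp_all add: pochhammer_same pochhammer_fact[symmetric])
    moreover have "pochhammer (- real n) j * fact (n - j) = (- 1) ^ j * fact n"
      using pochhammer_split_reflect[of "n - j" n "- real n"] that
      by (cases "even n"; cases "even j") (simp_all add: pochhammer_same pochhammer_fact[symmetric])
    ultimately have "pochhammer (- real n) (n - j) / fact (n - j) =
        (- 1) ^ n * (pochhammer (- real n) j / fact j)"
      by (simp add: field_simps)
    moreover have "pochhammer b (n - j) / pochhammer c (n - j) = pochhammer b n / pochhammer c n *
        (pochhammer (1 - c - real n) j / pochhammer (1 - b - real n) j)"
      using assms split[of b] split[of c] by (simp add: divide_simps)
    moreover have "coeff (hypergeom_poly n b c) (n - j) = pochhammer (- real n) (n - j) / fact (n - j) *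
        (pochhammer b (n - j) / pochhammer c (n - j))"
      by (simp add: coeff_hypergeom_poly)
    ultimately show ?thesis by (simp add: coeff_hypergeom_poly K_def mult_ac)
  qed
  have "poly (hypergeom_poly n b c) x = (\<Sum>j\<le>n. coeff (hypergeom_poly n b c) (n - j) * x ^ (n - j))"
    unfolding poly_hypergeom_poly
    by (rule sum.reindex_bij_witness[of _ "\<lambda>j. n - j" "\<lambda>j. n - j"]) auto
  also have "\<dots> = (\<Sum>j\<le>n. K * x ^ n *
      (coeff (hypergeom_poly n (1 - c - real n) (1 - b - real n)) j * (1 / x) ^ j))"
    using assms by (intro sum.cong) (auto simp: coeff power_diff power_divide)
  finally show ?thesis by (simp add: poly_hypergeom_poly[of n "1 - c - real n"] sum_distrib_left K_def)
qed

text \<open>Induction on \<open>n\<close>: the induction hypothesis at (b + 1, c + 1) and its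
  derivative turn the first recurrence in x into the second one in w = x/(x - 1).\<close>

lemma hypergeom_poly_pfaff:
  assumes "c > 0" "x \<noteq> 1"
  shows "poly (hypergeom_poly n b c) x = (1 - x) ^ n * poly (hypergeom_poly n (c - b) c) (x / (x - 1))"
  using assms
proof (induction n arbitrary: b c x)
  case 0
  then show ?case by (simp add: hypergeom_poly_def monom_0)
next
  case (Suc n)
  define G F where "G = hypergeom_poly n (b + 1) (c + 1)" and "F = hypergeom_poly n (c - b) (c + 1)"
  define w where "w = x / (x - 1)"
  have IH: "poly G y = (1 - y) ^ n * poly F (y / (y - 1))" if "y \<noteq> 1" for y
    using Suc.IH[of "c + 1" y "b + 1"] Suc.prems that by (simp add: G_def F_def)
  have "((\<lambda>y. y / (y - 1)) has_real_derivative - (1 / (x - 1)\<^sup>2)) (at x)"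
    using Suc.prems by (auto intro!: derivative_eq_intros simp: power2_eq_square divide_simps)
  then have "((\<lambda>y. poly F (y / (y - 1))) has_real_derivative
      poly (pderiv F) w * - (1 / (x - 1)\<^sup>2)) (at x)"
    unfolding w_def by (rule DERIV_chain'[OF _ poly_DERIV])
  moreover have "((\<lambda>y. (1 - y) ^ n) has_real_derivative - (real n * (1 - x) ^ (n - 1))) (at x)"
    by (auto intro!: derivative_eq_intros)
  ultimately have "((\<lambda>y. (1 - y) ^ n * poly F (y / (y - 1))) has_real_derivative
      - (real n * (1 - x) ^ (n - 1)) * poly F w
      + poly (pderiv F) w * - (1 / (x - 1)\<^sup>2) * (1 - x) ^ n) (at x)"
    unfolding w_def by (rule DERIV_mult[rotated])
  then have "(poly G has_real_derivative - (real n * (1 - x) ^ (n - 1)) * poly F w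
      + poly (pderiv F) w * - (1 / (x - 1)\<^sup>2) * (1 - x) ^ n) (at x)"
    by (rule has_field_derivative_transform_within_open[where S = "- {1}"])
       (use Suc.prems IH in auto)
  then have G': "poly (pderiv G) x = - (real n * (1 - x) ^ (n - 1)) * poly F w
      - poly (pderiv F) w * (1 / (x - 1)\<^sup>2) * (1 - x) ^ n"
    using DERIV_unique[OF poly_DERIV] by fastforce
  \<comment> \<open>For n = 0 the exponent \<open>n - 1\<close> truncates to 0, but the factor
    \<open>real n\<close> makes both sides 0.\<close>
  have n: "real n * (1 - x) ^ (n - 1) * (1 - x) = real n * (1 - x) ^ n"
    by (cases n) auto
  have w: "(1 - x) * w = - x" "(1 - x) * (1 - w) = 1" "x * (1 - x) * (1 / (x - 1)\<^sup>2) = - w"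
    using Suc.prems by (simp_all add: w_def divide_simps power2_eq_square) (simp_all add: algebra_simps)
  have "c * poly (hypergeom_poly (Suc n) b c) x =
      (c + (real n - b) * x) * poly G x + x * (1 - x) * poly (pderiv G) x"
    using arg_cong[OF hypergeom_poly_rodrigues_step[OF Suc.prems(1), of n b], of "\<lambda>p. poly p x"]
    by (simp add: G_def algebra_simps)
  also have "\<dots> = (c + (real n - b) * x) * ((1 - x) ^ n * poly F w)
      - x * (real n * (1 - x) ^ (n - 1) * (1 - x)) * poly F w
      - (x * (1 - x) * (1 / (x - 1)\<^sup>2)) * (poly (pderiv F) w * (1 - x) ^ n)"
    unfolding G' IH[OF Suc.prems(2)] w_def by (simp add: algebra_simps)
  also have "\<dots> = (1 - x) ^ n * ((c - b * x) * poly F w + w * poly (pderiv F) w)"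
    unfolding n w by (simp add: algebra_simps)
  \<comment> \<open>Using (1 - x)w = -x and (1 - x)(1 - w) = 1, one more factor 1 - x is made
    visible in both terms.\<close>
  also have "\<dots> = (1 - x) ^ n * ((c * (1 - x) - (c - b) * ((1 - x) * w)) * poly F w
      + w * ((1 - x) * (1 - w)) * poly (pderiv F) w)"
    unfolding w by (simp add: algebra_simps)
  also have "\<dots> = (1 - x) ^ Suc n * ((c - (c - b) * w) * poly F w + w * (1 - w) * poly (pderiv F) w)"
    by (simp add: algebra_simps)
  also have "(c - (c - b) * w) * poly F w + w * (1 - w) * poly (pderiv F) w =
      c * poly (hypergeom_poly (Suc n) (c - b) c) w"
    using arg_cong[OF hypergeom_poly_contiguous_step[OF Suc.prems(1), of n "c - b"], of "\<lambda>p. poly p w"]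
    by (simp add: F_def algebra_simps)
  finally show ?case using Suc.prems(1) by (simp add: w_def)
qed

section \<open>The three parameter ranges\<close>

lemma all_zeros_real_simple_degree_1:
  assumes "degree p = 1"
  shows "all_zeros_real_simple p"
proof -
  obtain u v where p: "p = [:u, v:]" "v \<noteq> 0"
    using assms by (metis degree1_coeffs One_nat_def)
  then have "poly p (- u / v) = 0" by simp
  then show ?thesis using assms
    by (intro all_zeros_real_simple_if_card[of p 1 "{- u / v}"]) auto
qed

text \<open>For n = 1 the only zero is c/b, and the ranges alone do not fix its position: in (i) it
  is negative if b < 0, in (ii) if c > 0, and in (iii) it exceeds 1 only if b < c. Hence the side
  conditions at n = 1; reality and simplicity hold there by linearity.\<close>

theorem theorem8:
  fixes n :: nat and b c :: real
  assumes "n \<ge> 1"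
    and "b \<notin> {- real j | j. j < n}"
    and "c \<notin> {- real j | j. j < n}"
  shows
    "(c > 0 \<and> c + real n - 2 < b \<and> b < c + real n - 1 \<longrightarrow>
       all_zeros_real_simple (hypergeom_poly n b c) \<and>
       ((n = 1 \<longrightarrow> b > 0) \<longrightarrow>
          card {x. 0 < x \<and> x < 1 \<and> poly (hypergeom_poly n b c) x = 0} = n - 1 \<and>
          (\<exists>!x. 1 < x \<and> poly (hypergeom_poly n b c) x = 0))) \<and>
     (b < 1 - real n \<and> c + real n - 2 < b \<and> b < c + real n - 1 \<longrightarrow>
       all_zeros_real_simple (hypergeom_poly n b c) \<and>
       ((n = 1 \<longrightarrow> c < 0) \<longrightarrow>
          card {x. 1 < x \<and> poly (hypergeom_poly n b c) x = 0} = n - 1 \<and>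
          (\<exists>!x. 0 < x \<and> x < 1 \<and> poly (hypergeom_poly n b c) x = 0))) \<and>
     (c > 0 \<and> 1 - real n < b \<and> b < 2 - real n \<longrightarrow>
       all_zeros_real_simple (hypergeom_poly n b c) \<and>
       ((n = 1 \<longrightarrow> b < c) \<longrightarrow>
          card {x. x < 0 \<and> poly (hypergeom_poly n b c) x = 0} = n - 1 \<and>
          (\<exists>!x. 1 < x \<and> poly (hypergeom_poly n b c) x = 0)))"
proof -
  let ?p = "hypergeom_poly n b c"
  have nz: "pochhammer b n \<noteq> 0" "pochhammer c n \<noteq> 0"
    using assms(2,3) pochhammer_nonzero_iff_notin by blast+
  note deg = degree_hypergeom_poly[OF nz]
  have linear: "all_zeros_real_simple ?p" if "n = 1"
    using all_zeros_real_simple_degree_1 deg that by simp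
  note split = zeros_split[OF deg hypergeom_poly_nonzero assms(1)]
  have i: "all_zeros_real_simple ?p \<and> card {x. (0 < x \<and> x < 1) \<and> poly ?p x = 0} = n - 1 \<and>
      (\<exists>!x. 1 < x \<and> poly ?p x = 0)"
    if range: "c > 0" "c + real n - 2 < b" "b < c + real n - 1" "n = 1 \<longrightarrow> b > 0"
  proof -
    have "b > 0" using range assms(1) by (cases "n = 1") auto
    obtain S y where S: "finite S" "card S = n - 1" "S \<subseteq> {0<..<1}"
        "\<forall>x\<in>S. poly ?p x = 0" and y: "y > 1" "poly ?p y = 0"
      by (rule hypergeom_poly_zeros_quasi_jacobi[OF assms(1) range(1) \<open>b > 0\<close> range(2,3)])
    show ?thesis by (rule split[of S _ _ y]) (use S y in auto)
  qed
  have ii: "all_zeros_real_simple ?p \<and> card {x. 1 < x \<and> poly ?p x = 0} = n - 1 \<and>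
      (\<exists>!x. (0 < x \<and> x < 1) \<and> poly ?p x = 0)"
    if range: "b < 1 - real n" "c + real n - 2 < b" "b < c + real n - 1" "n = 1 \<longrightarrow> c < 0"
  proof -
    \<comment> \<open>Reversal keeps the difference of upper and lower parameter equal to b - c, so
      the window of (i) is preserved, and b < 1 - n makes the new lower parameter positive.\<close>
    let ?r = "hypergeom_poly n (1 - c - real n) (1 - b - real n)"
    have "1 - c - real n > 0" using range assms(1) by (cases "n = 1") auto
    obtain S y where S: "finite S" "card S = n - 1" "S \<subseteq> {0<..<1}"
        "\<forall>x\<in>S. poly ?r x = 0" and y: "y > 1" "poly ?r y = 0"
    proof (rule hypergeom_poly_zeros_quasi_jacobi[OF assms(1) _ \<open>1 - c - real n > 0\<close>])
      show "1 - b - real n > 0" "1 - b - real n + real n - 2 < 1 - c - real n"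
        "1 - c - real n < 1 - b - real n + real n - 1"
        using range by simp_all
    qed
    have zero: "poly ?p (1 / x) = 0" if "poly ?r x = 0" "x \<noteq> 0" for x
      using hypergeom_poly_reverse[OF nz, of "1 / x"] that by simp
    show ?thesis
    proof (rule split[of "(\<lambda>x. 1 / x) ` S" _ _ "1 / y"])
      show "card ((\<lambda>x. 1 / x) ` S) = n - 1"
        using S by (subst card_image) (auto simp: inj_on_def)
      show "1 < x \<and> poly ?p x = 0" if "x \<in> (\<lambda>x. 1 / x) ` S" for x
        using that S zero by fastforce
    qed (use S y zero in auto)
  qed
  have iii: "all_zeros_real_simple ?p \<and> card {x. x < 0 \<and> poly ?p x = 0} = n - 1 \<and>
      (\<exists>!x. 1 < x \<and> poly ?p x = 0)"
    if range: "c > 0" "1 - real n < b" "b < 2 - real n" "n = 1 \<longrightarrow> b < c"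
  proof -
    \<comment> \<open>Replacing b by c - b turns 1 - n < b < 2 - n into the window of (i). The
      involution \<open>?f\<close> maps (0, 1) onto the negative axis and (1, infinity) onto
      itself.\<close>
    let ?r = "hypergeom_poly n (c - b) c" and ?f = "\<lambda>x. x / (x - 1)"
    have "c - b > 0" using range assms(1) by (cases "n = 1") auto
    obtain S y where S: "finite S" "card S = n - 1" "S \<subseteq> {0<..<1}"
        "\<forall>x\<in>S. poly ?r x = 0" and y: "y > 1" "poly ?r y = 0"
    proof (rule hypergeom_poly_zeros_quasi_jacobi[OF assms(1) \<open>c > 0\<close> \<open>c - b > 0\<close>])
      show "c + real n - 2 < c - b" "c - b < c + real n - 1"
        using range by simp_all
    qed
    have inv: "?f x \<noteq> 1" "?f (?f x) = x" if "x \<noteq> 1" for x :: real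
      using that by (auto simp: divide_simps)
    have zero: "poly ?p (?f x) = 0" if "poly ?r x = 0" "x \<noteq> 1" for x
      using hypergeom_poly_pfaff[OF \<open>c > 0\<close> inv(1), of x n b] inv(2)[of x] that by simp
    show ?thesis
    proof (rule split[of "?f ` S" _ _ "?f y"])
      have "inj_on ?f S" by (rule inj_on_inverseI[of _ ?f]) (use inv S in auto)
      then show "card (?f ` S) = n - 1" using S by (simp add: card_image)
      show "x < 0 \<and> poly ?p x = 0" if "x \<in> ?f ` S" for x
        using that S zero by (force simp: divide_neg_pos divide_pos_neg)
    qed (use S y zero in auto)
  qed
  show ?thesis
    using i ii iii linear unfolding conj_assoc by argo
qed

end
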